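(* Let $k\in\mathbb{N}$ and let $\mathcal{R}$ be a binary structure of type $k$ on a set $V$. Then the relations $\simeq_{\le 3,\mathcal{R}}$ and $\simeq_{\mathcal{R}}$ on $V$ coincide.
   Context: A binary structure of type $k$ is $\mathcal{R}=(V,\rho_1,\dots,\rho_k)$ with binary relations $\rho_i$ on $V$. For $x,y\in V$ and $F\subseteq V\setminus\{x,y\}$, $x\simeq_{F,\mathcal{R}}y$ means that the restrictions of $\mathcal{R}$ to $\{x\}\cup F$ and to $\{y\}\cup F$ are isomorphic. For an integer $m$, $x\simeq_{m,\mathcal{R}}y$ means $x\simeq_{F,\mathcal{R}}y$ for every $m$-element $F\subseteq V\setminus\{x,y\}$; $x\simeq_{\le m,\mathcal{R}}y$ means $x\simeq_{m',\mathcal{R}}y$ for all $m'\le m$; $x\simeq_{\mathcal{R}}y$ means $x\simeq_{m,\mathcal{R}}y$ for all integers $m$. *)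

theory Defs
  imports Main
begin

text \<open>
  A structure consists of its base set and the tuple of its relations, kept as a list.
  The predicate \<open>binary_structure k\<close> says that the list has length \<open>k\<close> and
  that its entries are relations on the base set.
\<close>

record 'a bstruct =
  base :: "'a set"
  rels :: "'a rel list"

definition binary_structure :: "nat \<Rightarrow> 'a bstruct \<Rightarrow> bool" where
  "binary_structure k R \<longleftrightarrow>
     length (rels R) = k \<and> (\<forall>\<rho> \<in> set (rels R). \<rho> \<subseteq> base R \<times> base R)"

definition restriction :: "'a bstruct \<Rightarrow> 'a set \<Rightarrow> 'a bstruct" where
  "restriction R A = \<lparr>base = base R \<inter> A, rels = map (\<lambda>\<rho>. \<rho> \<inter> A \<times> A) (rels R)\<rparr>"

definition isomorphism :: "'a bstruct \<Rightarrow> 'b bstruct \<Rightarrow> ('a \<Rightarrow> 'b) \<Rightarrow> bool" where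
  "isomorphism R S f \<longleftrightarrow>
     length (rels R) = length (rels S) \<and>
     bij_betw f (base R) (base S) \<and>
     (\<forall>i < length (rels R). \<forall>u \<in> base R. \<forall>v \<in> base R.
        (u, v) \<in> rels R ! i \<longleftrightarrow> (f u, f v) \<in> rels S ! i)"

definition isomorphic :: "'a bstruct \<Rightarrow> 'b bstruct \<Rightarrow> bool" where
  "isomorphic R S \<longleftrightarrow> (\<exists>f. isomorphism R S f)"

text \<open>
  The isomorphism between the two restrictions is arbitrary: it need neither send \<open>x\<close> to
  \<open>y\<close> nor fix \<open>F\<close> pointwise or setwise.
\<close>

definition equiv_set :: "'a bstruct \<Rightarrow> 'a set \<Rightarrow> 'a \<Rightarrow> 'a \<Rightarrow> bool" where
  "equiv_set R F x y \<longleftrightarrow>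
     isomorphic (restriction R ({x} \<union> F)) (restriction R ({y} \<union> F))"

text \<open>
  The relations below are sets of pairs of elements of the base set. Sizes are natural numbers,
  since no set has negative size. The condition \<open>finite F\<close> is needed because
  \<open>card\<close> is 0 on infinite sets.
\<close>

definition equiv_size :: "nat \<Rightarrow> 'a bstruct \<Rightarrow> 'a rel" where
  "equiv_size m R =
     {(x, y) \<in> base R \<times> base R.
        \<forall>F. F \<subseteq> base R - {x, y} \<and> finite F \<and> card F = m \<longrightarrow> equiv_set R F x y}"

definition equiv_upto :: "nat \<Rightarrow> 'a bstruct \<Rightarrow> 'a rel" where
  "equiv_upto m R = {(x, y) \<in> base R \<times> base R. \<forall>m' \<le> m. (x, y) \<in> equiv_size m' R}"

definition equiv_all :: "'a bstruct \<Rightarrow> 'a rel" where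
  "equiv_all R = {(x, y) \<in> base R \<times> base R. \<forall>m. (x, y) \<in> equiv_size m R}"

end

theory Submission imports Defs begin

text \<open>
  Colour an ordered pair \<open>(u, v)\<close> by the set of relations that contain it, and let \<open>D\<close> be the set
  of elements \<open>z\<close> whose coloured pairs with \<open>x\<close> and with \<open>y\<close> differ; these pairs are then reversals
  of each other. Sets \<open>F\<close> of size 2 show that \<open>D \<union> {x, y}\<close> is a module: no element outside
  distinguishes its members. Hence only the trace \<open>G\<close> of \<open>F\<close> on \<open>D\<close> matters.
  Sets of size 2 and 3 show that a trace with more than two elements is a chain, with \<open>x\<close> at
  one end and \<open>y\<close> at the other, so that \<open>{x} \<union> G\<close> and \<open>{y} \<union> G\<close> are isomorphic by a shift.
  Smaller traces are covered by the hypothesis.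
\<close>

section \<open>Isomorphisms between coloured sets\<close>

definition colour_iso :: "('a \<Rightarrow> 'a \<Rightarrow> 'c) \<Rightarrow> 'a set \<Rightarrow> 'a set \<Rightarrow> bool" where
  "colour_iso d A B \<longleftrightarrow> (\<exists>f. bij_betw f A B \<and> (\<forall>u\<in>A. \<forall>v\<in>A. d (f u) (f v) = d u v))"

text \<open>The primed elements are the images of \<open>x\<close>, \<open>p\<close> and
  \<open>q\<close>. Listing the six possible images turns the hypothesis for a two-element set into
  a finite case check on colours.\<close>

lemma colour_iso_triple:
  assumes "colour_iso d {x, p, q} {y, p, q}" "p \<noteq> q" "x \<notin> {p, q}"
  obtains x' p' q' where
    "(x', p', q') \<in> {(y, p, q), (y, q, p), (p, y, q), (p, q, y), (q, y, p), (q, p, y)}"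
    "d x' p' = d x p" "d p' x' = d p x" "d x' q' = d x q" "d q' x' = d q x"
    "d p' q' = d p q" "d q' p' = d q p"
proof -
  obtain f where f: "bij_betw f {x, p, q} {y, p, q}"
    and c: "\<forall>u\<in>{x, p, q}. \<forall>v\<in>{x, p, q}. d (f u) (f v) = d u v"
    using assms(1) by (auto simp: colour_iso_def)
  have im: "f x \<in> {y, p, q}" "f p \<in> {y, p, q}" "f q \<in> {y, p, q}"
    using bij_betw_apply[OF f] by simp_all
  note inj = inj_on_eq_iff[OF bij_betw_imp_inj_on[OF f]]
  have ne: "f x \<noteq> f p" "f x \<noteq> f q" "f p \<noteq> f q"
    using assms(2,3) by (simp_all add: inj)
  have "(f x, f p, f q) \<in> {(y, p, q), (y, q, p), (p, y, q), (p, q, y), (q, y, p), (q, p, y)}"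
    using im ne unfolding insert_iff empty_iff Pair_inject prod.inject by metis
  then show thesis
    by (rule that) (simp_all add: c)
qed

text \<open>Read \<open>d u v = a\<close> as "u lies below v": \<open>G\<close> is a chain, with
  \<open>x\<close> below it and \<open>y\<close> above it. The isomorphism moves each element of
  \<open>insert x G\<close> to its successor; the induction peels off the top of
  \<open>G\<close>.\<close>

lemma colour_iso_chain:
  assumes "finite G" "x \<notin> G" "y \<notin> G"
    and "\<And>u. u \<in> insert x (insert y G) \<Longrightarrow> d u u = l"
    and "\<And>z. z \<in> G \<Longrightarrow> d x z = a \<and> d z x = b \<and> d z y = a \<and> d y z = b"
    and "\<And>p q. \<lbrakk>p \<in> G; q \<in> G; p \<noteq> q\<rbrakk> \<Longrightarrow> d p q = a \<and> d q p = b \<or> d p q = b \<and> d q p = a"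
    and "\<And>p q r. \<lbrakk>p \<in> G; q \<in> G; r \<in> G; d p q = a; d q r = a; p \<noteq> q; q \<noteq> r; p \<noteq> r\<rbrakk> \<Longrightarrow> d p r = a"
    and "a \<noteq> b"
  shows "colour_iso d (insert x G) (insert y G)"
  using assms
proof (induction "card G" arbitrary: G y)
  case 0
  then have "G = {}" by (metis card_0_eq)
  moreover have "d x x = d y y" using 0(5)[of x] 0(5)[of y] by simp
  ultimately show ?case
    by (auto simp: colour_iso_def bij_betw_def intro!: exI[of _ "\<lambda>_. y"])
next
  case (Suc n)
  note fin = Suc.prems(1) and xy = Suc.prems(2,3) and ab = Suc.prems(8)
  note loop = Suc.prems(4) and ends = Suc.prems(5) and tot = Suc.prems(6) and tr = Suc.prems(7)
  define S where "S p q \<longleftrightarrow> p \<noteq> q \<and> d p q = a" for p q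
  have "transp_on G S"
  proof (rule transp_onI)
    fix p q r assume *: "p \<in> G" "q \<in> G" "r \<in> G" "S p q" "S q r"
    \<comment> \<open>If \<open>p = r\<close>, both directions between \<open>p\<close> and
      \<open>q\<close> would have colour \<open>a\<close>, although one of them has colour
      \<open>b\<close>.\<close>
    then have "p \<noteq> r" using tot[of p q] ab by (auto simp: S_def)
    with * tr[of p q r] show "S p r" by (auto simp: S_def)
  qed
  moreover have "asymp_on G S"
  proof (rule asymp_onI)
    fix p q assume "p \<in> G" "q \<in> G" "S p q"
    with tot[of p q] ab show "\<not> S q p" by (auto simp: S_def)
  qed
  moreover have "G \<noteq> {}" using Suc.hyps(2) by auto
  ultimately obtain z where z: "z \<in> G" "\<forall>u\<in>G. u \<noteq> z \<longrightarrow> \<not> S z u"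
    using Finite_Set.bex_max_element[OF fin, of S] by blast
  have top: "d u z = a \<and> d z u = b" if "u \<in> G - {z}" for u
    using that z(1) bspec[OF z(2), of u] tot[of u z] by (auto simp: S_def)
  \<comment> \<open>The top element \<open>z\<close> takes over the role of \<open>y\<close> for the
    shorter chain, which is why \<open>y\<close> varies in the induction.\<close>
  have "colour_iso d (insert x (G - {z})) (insert z (G - {z}))"
  proof (rule Suc.hyps(1))
    show "n = card (G - {z})" using Suc.hyps(2) z(1) by simp
    show "finite (G - {z})" "x \<notin> G - {z}" "z \<notin> G - {z}" using fin xy by auto
    show "d u u = l" if "u \<in> insert x (insert z (G - {z}))" for u
      using that z(1) by (intro loop) auto
    show "d x u = a \<and> d u x = b \<and> d u z = a \<and> d z u = b" if "u \<in> G - {z}" for u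
      using that ends[of u] top[of u] by auto
    show "d p q = a \<and> d q p = b \<or> d p q = b \<and> d q p = a"
      if "p \<in> G - {z}" "q \<in> G - {z}" "p \<noteq> q" for p q
      using that tot[of p q] by auto
    show "d p r = a" if "p \<in> G - {z}" "q \<in> G - {z}" "r \<in> G - {z}" "d p q = a" "d q r = a"
      "p \<noteq> q" "q \<noteq> r" "p \<noteq> r" for p q r
      using that tr[of p q r] by auto
  qed (rule ab)
  then obtain f where f: "bij_betw f (insert x (G - {z})) (insert z (G - {z}))"
    and c: "\<forall>u\<in>insert x (G - {z}). \<forall>v\<in>insert x (G - {z}). d (f u) (f v) = d u v"
    by (auto simp: colour_iso_def)
  have eq: "insert z (G - {z}) = G" using z(1) by auto
  define g where "g = f(z := y)"
  have zx: "z \<notin> insert x (G - {z})" using z(1) xy by auto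
  have "insert z (insert x (G - {z})) = insert x G" using z(1) by auto
  moreover have "bij_betw g (insert z (insert x (G - {z}))) (insert y G)"
  proof -
    have "bij_betw g (insert x (G - {z})) G"
      using f zx unfolding eq g_def by (subst bij_betw_cong[where g = f]) auto
    then show ?thesis
      using notIn_Un_bij_betw3[OF zx, of g G] xy by (simp add: g_def)
  qed
  ultimately have "bij_betw g (insert x G) (insert y G)" by (simp only:)
  moreover have "d (g u) (g v) = d u v" if "u \<in> insert x G" "v \<in> insert x G" for u v
  proof -
    have fG: "f w \<in> G" if "w \<in> insert x G" "w \<noteq> z" for w
      using that bij_betw_apply[OF f, of w] unfolding eq by simp
    \<comment> \<open>In the source \<open>z\<close> lies above everything else, just as
      \<open>y\<close> lies above \<open>G\<close>, where \<open>f\<close> takes its values. Hence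
      sending \<open>z\<close> to \<open>y\<close> preserves colours.\<close>
    have below: "d w z = a \<and> d z w = b" if "w \<in> insert x G" "w \<noteq> z" for w
      using that top[of w] ends[OF z(1)] by auto
    have diag: "d y y = d z z" using loop z(1) by auto
    consider "u \<noteq> z" "v \<noteq> z" | "u = z" "v = z" | "u = z" "v \<noteq> z" | "u \<noteq> z" "v = z" by auto
    then show ?thesis
    proof cases
      case 1
      then show ?thesis using that c[rule_format, of u v] by (simp add: g_def)
    next
      case 2
      then show ?thesis using diag by (simp add: g_def)
    next
      case 3
      then show ?thesis using that fG[of v] below[of v] ends[of "f v"] by (simp add: g_def)
    next
      case 4
      then show ?thesis using that fG[of u] below[of u] ends[of "f u"] by (simp add: g_def)
    qed
  qed
  ultimately show ?case unfolding colour_iso_def by blast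
qed

text \<open>Extend the given isomorphism by the identity on \<open>H\<close>. Mixed pairs keep their
  colours because no element of \<open>H\<close> distinguishes a point from its image.\<close>

lemma colour_iso_module_extend:
  assumes "colour_iso d (insert x G) (insert y G)"
    and "x \<notin> H" "y \<notin> H" "G \<inter> H = {}"
    and "\<And>u w. \<lbrakk>u \<in> insert y G; w \<in> H\<rbrakk> \<Longrightarrow> d u w = d x w \<and> d w u = d w x"
  shows "colour_iso d (insert x (G \<union> H)) (insert y (G \<union> H))"
proof -
  obtain f where f: "bij_betw f (insert x G) (insert y G)"
    and c: "\<forall>u\<in>insert x G. \<forall>v\<in>insert x G. d (f u) (f v) = d u v"
    using assms(1) by (auto simp: colour_iso_def)
  define g where "g u = (if u \<in> H then u else f u)" for u
  have "bij_betw g (insert x G) (insert y G)"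
    using f assms(2,4) by (subst bij_betw_cong[where g = f]) (auto simp: g_def)
  moreover have "bij_betw g H H"
    by (subst bij_betw_cong[where g = id]) (auto simp: g_def)
  ultimately have "bij_betw g (insert x G \<union> H) (insert y G \<union> H)"
    by (rule bij_betw_combine) (use assms in auto)
  moreover have "d (g u) (g v) = d u v" if "u \<in> insert x G \<union> H" "v \<in> insert x G \<union> H" for u v
  proof -
    note fG = bij_betw_apply[OF f]
    have m: "d t w = d x w \<and> d w t = d w x" if "t \<in> insert x (insert y G)" "w \<in> H" for t w
      using that assms(5)[of t w] by auto
    show ?thesis
    proof (cases "u \<in> H"; cases "v \<in> H")
      assume "u \<in> H" "v \<notin> H"
      then show ?thesis using that m[of v u] m[of "f v" u] fG[of v] by (auto simp: g_def)
    next
      assume "u \<notin> H" "v \<in> H"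
      then show ?thesis using that m[of u v] m[of "f u" v] fG[of u] by (auto simp: g_def)
    qed (use that c[rule_format, of u v] in \<open>auto simp: g_def\<close>)
  qed
  ultimately show ?thesis
    unfolding colour_iso_def Un_insert_left[symmetric] by blast
qed

section \<open>Pairs exchangeable over sets of at most three elements\<close>

locale exchange_upto_3 =
  fixes d :: "'a \<Rightarrow> 'a \<Rightarrow> 'c" and V :: "'a set" and x y :: 'a
  assumes small: "\<lbrakk>F \<subseteq> V - {x, y}; finite F; card F \<le> 3\<rbrakk> \<Longrightarrow> colour_iso d (insert x F) (insert y F)"
begin

definition D :: "'a set" where
  "D = {z \<in> V - {x, y}. \<not> (d x z = d y z \<and> d z x = d z y)}"

lemma loop: "d x x = d y y"
  using small[of "{}"] by (auto simp: colour_iso_def bij_betw_def)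

text \<open>An isomorphism fixing \<open>z\<close> would contradict \<open>z \<in> D\<close>, so it
  sends \<open>x\<close> to \<open>z\<close> and \<open>z\<close> to \<open>y\<close>. If the
  colours of \<open>(x, z)\<close> and \<open>(z, x)\<close> agreed, \<open>z\<close> would again
  not distinguish \<open>x\<close> from \<open>y\<close>.\<close>

lemma D_reversal:
  assumes "z \<in> D"
  shows "d z y = d x z" "d y z = d z x" "d z z = d x x" "d x z \<noteq> d z x"
proof -
  have z: "z \<in> V - {x, y}" using assms by (auto simp: D_def)
  then have "colour_iso d {x, z} {y, z}"
    using small[of "{z}"] by auto
  then obtain f where f: "bij_betw f {x, z} {y, z}"
    and c: "\<forall>u\<in>{x, z}. \<forall>v\<in>{x, z}. d (f u) (f v) = d u v"
    by (auto simp: colour_iso_def)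
  have "f x \<in> {y, z}" "f z \<in> {y, z}" "f x \<noteq> f z"
    using bij_betwE[OF f] bij_betw_imp_inj_on[OF f] z by (auto simp: inj_on_def)
  then have "f x = y \<and> f z = z \<or> f x = z \<and> f z = y" by auto
  then have *: "d y z = d x z \<and> d z y = d z x \<or> d z y = d x z \<and> d y z = d z x \<and> d z z = d x x"
    using c by auto
  then show "d z y = d x z" "d y z = d z x" "d z z = d x x"
    using assms by (auto simp: D_def)
  with assms show "d x z \<noteq> d z x" by (auto simp: D_def)
qed

text \<open>If \<open>x\<close> goes to \<open>y\<close>, then \<open>p\<close> and \<open>q\<close>
  must be swapped, which gives the last alternative. Otherwise only the shifts x -> p -> q -> y and
  x -> q -> p -> y survive the asymmetry in \<open>D_reversal\<close>, and they give the first
  two.\<close>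

lemma D_pair:
  assumes "p \<in> D" "q \<in> D" "p \<noteq> q"
  shows "d x q = d x p \<and> d q x = d p x \<and>
           (d p q = d x p \<and> d q p = d p x \<or> d p q = d p x \<and> d q p = d x p) \<or>
         d x q = d p x \<and> d q x = d x p \<and> d p q = d q p"
proof -
  have "{p, q} \<subseteq> V - {x, y}" using assms by (auto simp: D_def)
  then have "colour_iso d {x, p, q} {y, p, q}" "x \<notin> {p, q}"
    using small[of "{p, q}"] by (auto simp: card_insert_if)
  from colour_iso_triple[OF this(1) \<open>p \<noteq> q\<close> this(2)] obtain x' p' q' where
    perm: "(x', p', q') \<in> {(y, p, q), (y, q, p), (p, y, q), (p, q, y), (q, y, p), (q, p, y)}"
    and eqs: "d x' p' = d x p" "d p' x' = d p x" "d x' q' = d x q" "d q' x' = d q x"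
      "d p' q' = d p q" "d q' p' = d q p" .
  note rev = D_reversal[OF assms(1)] D_reversal[OF assms(2)]
  from perm show ?thesis
    by (elim insertE emptyE Pair_inject) (use eqs rev in \<open>smt (verit)\<close>)+
qed

text \<open>Two isomorphisms survive the asymmetry in \<open>D_reversal\<close>: x -> p -> y with
  \<open>w\<close> fixed, and the shift x -> p -> w -> y. Either one gives the claim.\<close>

lemma D_module:
  assumes "p \<in> D" "w \<in> V - {x, y}" "w \<notin> D"
  shows "d p w = d x w \<and> d w p = d w x"
proof -
  have w: "d y w = d x w" "d w y = d w x" "p \<noteq> w" using assms by (auto simp: D_def)
  have "{p, w} \<subseteq> V - {x, y}" using assms by (auto simp: D_def)
  then have "colour_iso d {x, p, w} {y, p, w}" "x \<notin> {p, w}"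
    using small[of "{p, w}"] by (auto simp: card_insert_if)
  from colour_iso_triple[OF this(1) w(3) this(2)] obtain x' p' w' where
    perm: "(x', p', w') \<in> {(y, p, w), (y, w, p), (p, y, w), (p, w, y), (w, y, p), (w, p, y)}"
    and eqs: "d x' p' = d x p" "d p' x' = d p x" "d x' w' = d x w" "d w' x' = d w x"
      "d p' w' = d p w" "d w' p' = d w p" .
  note rev = D_reversal[OF assms(1)] w
  from perm show ?thesis
    by (elim insertE emptyE Pair_inject) (use eqs rev in \<open>smt (verit)\<close>)+
qed

text \<open>The image of \<open>x\<close> would have to dominate the three other elements, and none does.\<close>

lemma D_no_cycle:
  assumes "p \<in> D" "q \<in> D" "r \<in> D" "p \<noteq> q" "q \<noteq> r" "p \<noteq> r"
    and "d x q = d x p" "d x r = d x p" "d p q = d x p" "d q r = d x p"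
  shows "d p r = d x p"
proof (rule ccontr)
  assume neg: "d p r \<noteq> d x p"
  have "{p, q, r} \<subseteq> V - {x, y}" using assms by (auto simp: D_def)
  then have "colour_iso d {x, p, q, r} {y, p, q, r}" "x \<notin> {p, q, r}" "y \<notin> {p, q, r}"
    using small[of "{p, q, r}"] by (auto simp: card_insert_if)
  then obtain f where f: "bij_betw f {x, p, q, r} {y, p, q, r}"
    and c: "\<forall>u\<in>{x, p, q, r}. \<forall>v\<in>{x, p, q, r}. d (f u) (f v) = d u v"
    by (auto simp: colour_iso_def)
  have dom: "d (f x) v = d x p" if "v \<in> {y, p, q, r}" "v \<noteq> f x" for v
  proof -
    from that(1) obtain u where "u \<in> {x, p, q, r}" "v = f u"
      using bij_betw_imp_surj_on[OF f] by blast
    then show ?thesis using that(2) c assms(7,8) by auto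
  qed
  have "f x \<in> {y, p, q, r}" using bij_betwE[OF f] by auto
  \<comment> \<open>Domination fails for \<open>y\<close> over \<open>p\<close>, for
    \<open>p\<close> over \<open>r\<close>, for \<open>q\<close> over \<open>p\<close> and for
    \<open>r\<close> over \<open>q\<close>.\<close>
  then consider "f x = y" | "f x = p" | "f x = q" | "f x = r" by auto
  then show False
  proof cases
    case 1
    then show ?thesis
      using dom[of p] D_reversal[OF \<open>p \<in> D\<close>] \<open>y \<notin> {p, q, r}\<close> by auto
  next
    case 2
    then show ?thesis using dom[of r] neg assms(6) by auto
  next
    case 3
    then show ?thesis
      using dom[of p] assms(4,7,9) D_pair[OF \<open>p \<in> D\<close> \<open>q \<in> D\<close>] D_reversal(4)[OF \<open>p \<in> D\<close>] by auto
  next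
    case 4
    then show ?thesis
      using dom[of q] assms(5,7,8,10) D_pair[OF \<open>q \<in> D\<close> \<open>r \<in> D\<close>] D_reversal(4)[OF \<open>q \<in> D\<close>] by auto
  qed
qed

text \<open>Otherwise \<open>D_pair\<close> joins \<open>r\<close> symmetrically to \<open>p\<close>
  and \<open>q\<close>. Since \<open>x\<close> is joined asymmetrically to all three, its image must
  be \<open>y\<close>. But \<open>y\<close> sees neither \<open>p\<close> nor \<open>q\<close> in
  the colour \<open>d x p\<close>, so \<open>p\<close> and \<open>q\<close> would both have to map
  to \<open>r\<close>.\<close>

lemma D_not_mixed:
  assumes "p \<in> D" "q \<in> D" "r \<in> D" "p \<noteq> q" "q \<noteq> r" "p \<noteq> r" "d x q = d x p"
  shows "d x r = d x p"
proof (rule ccontr)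
  assume neg: "d x r \<noteq> d x p"
  have "{p, q, r} \<subseteq> V - {x, y}" using assms by (auto simp: D_def)
  then have "colour_iso d {x, p, q, r} {y, p, q, r}" "x \<notin> {p, q, r}" "y \<notin> {p, q, r}"
    using small[of "{p, q, r}"] by (auto simp: card_insert_if)
  then obtain f where f: "bij_betw f {x, p, q, r} {y, p, q, r}"
    and c: "\<forall>u\<in>{x, p, q, r}. \<forall>v\<in>{x, p, q, r}. d (f u) (f v) = d u v"
    by (auto simp: colour_iso_def)
  note rev = D_reversal[OF \<open>p \<in> D\<close>] D_reversal[OF \<open>q \<in> D\<close>] D_reversal[OF \<open>r \<in> D\<close>]
  have pr: "d x r = d p x" "d r x = d x p" "d p r = d r p"
    using D_pair[OF \<open>p \<in> D\<close> \<open>r \<in> D\<close>] neg assms(6) by auto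
  have qr: "d q r = d r q"
    using D_pair[OF \<open>q \<in> D\<close> \<open>r \<in> D\<close>] neg assms(5,7) by auto
  have nonsym: "d (f x) v \<noteq> d v (f x)" if "v \<in> {y, p, q, r}" "v \<noteq> f x" for v
  proof -
    from that(1) obtain u where "u \<in> {x, p, q, r}" "v = f u"
      using bij_betw_imp_surj_on[OF f] by blast
    then show ?thesis using that(2) c rev by auto
  qed
  have "f x \<in> {y, p, q, r}" using bij_betwE[OF f] by auto
  then have fx: "f x = y"
    using nonsym[of r] nonsym[of p] pr(3) qr assms(5,6) by auto
  have "f p \<noteq> f q" "f p \<noteq> y" "f q \<noteq> y"
    using bij_betw_imp_inj_on[OF f] fx \<open>x \<notin> {p, q, r}\<close> assms(4) by (auto simp: inj_on_def)
  moreover have "f p \<in> {y, p, q, r}" "f q \<in> {y, p, q, r}" using bij_betwE[OF f] by auto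
  ultimately have "f p \<in> {p, q} \<or> f q \<in> {p, q}" by auto
  moreover have "d y (f p) = d x p" "d y (f q) = d x p"
    using c assms(7) by (auto simp flip: fx)
  ultimately show False using rev assms(7) by auto
qed

lemma colour_iso_finite:
  assumes "F \<subseteq> V - {x, y}" "finite F"
  shows "colour_iso d (insert x F) (insert y F)"
proof -
  have G: "colour_iso d (insert x (F \<inter> D)) (insert y (F \<inter> D))"
  \<comment> \<open>A trace of at most three elements is itself a set covered by
    \<open>small\<close>, whatever the size of \<open>F\<close>.\<close>
  proof (cases "card (F \<inter> D) \<le> 3")
    case True
    then show ?thesis using assms by (intro small) auto
  next
    case False
    then have "F \<inter> D \<noteq> {}" by force
    then obtain p where p: "p \<in> F \<inter> D" by blast
    then have pD: "p \<in> D" by blast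
    have one: "d x q = d x p" if q: "q \<in> F \<inter> D" for q
    proof (rule ccontr)
      assume neg: "d x q \<noteq> d x p"
      \<comment> \<open>The size of the trace supplies a third element \<open>r\<close>. By
        \<open>D_pair\<close>, \<open>x\<close> sees \<open>r\<close> as it sees \<open>p\<close> or
        as it sees \<open>q\<close>; in both cases \<open>D_not_mixed\<close> forces
        \<open>p\<close> and \<open>q\<close> to look alike.\<close>
      have "card {p, q} \<le> 2" by (simp add: card_insert_if)
      then have "\<not> F \<inter> D \<subseteq> {p, q}"
        using False card_mono[of "{p, q}" "F \<inter> D"] by fastforce
      then obtain r where r: "r \<in> F \<inter> D" "r \<noteq> p" "r \<noteq> q" by blast
      have qr: "q \<in> D" "r \<in> D" "p \<noteq> q" using q r(1) neg by auto
      have "d x q = d p x" using D_pair[OF pD qr(1,3)] neg by argo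
      moreover have "d x r = d x p \<or> d x r = d p x"
        using D_pair[OF pD qr(2)] r(2) by argo
      ultimately have "d x r = d x p \<or> d x r = d x q" by simp
      then show False
        using D_not_mixed[OF pD qr(2,1)] D_not_mixed[OF qr(1,2) pD] qr(3) r(2,3) neg by metis
    qed
    note ne = D_reversal(4)[OF pD]
    have two: "d q x = d p x" if "q \<in> F \<inter> D" for q
    proof (cases "p = q")
      case False
      then show ?thesis using D_pair[OF pD, of q] one[OF that] ne that by (metis IntD2)
    qed simp
    show ?thesis
    proof (rule colour_iso_chain[where a = "d x p" and b = "d p x" and l = "d x x"])
      show "finite (F \<inter> D)" "x \<notin> F \<inter> D" "y \<notin> F \<inter> D" using assms by auto
      show "d u u = d x x" if "u \<in> insert x (insert y (F \<inter> D))" for u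
        using that loop D_reversal(3)[of u] by auto
      show "d x z = d x p \<and> d z x = d p x \<and> d z y = d x p \<and> d y z = d p x" if "z \<in> F \<inter> D" for z
        using one[OF that] two[OF that] D_reversal(1,2)[of z] that by simp
      show "d u v = d x p \<and> d v u = d p x \<or> d u v = d p x \<and> d v u = d x p"
        if "u \<in> F \<inter> D" "v \<in> F \<inter> D" "u \<noteq> v" for u v
        using D_pair[of u v] one[OF that(1)] one[OF that(2)] two[OF that(1)] that ne by simp
      show "d u w = d x p" if "u \<in> F \<inter> D" "v \<in> F \<inter> D" "w \<in> F \<inter> D"
        "d u v = d x p" "d v w = d x p" "u \<noteq> v" "v \<noteq> w" "u \<noteq> w" for u v w
        using D_no_cycle[of u v w] one[OF that(1)] one[OF that(2)] one[OF that(3)] that by simp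
      show "d x p \<noteq> d p x" by (rule ne)
    qed
  qed
  have "colour_iso d (insert x (F \<inter> D \<union> (F - D))) (insert y (F \<inter> D \<union> (F - D)))"
  proof (rule colour_iso_module_extend[OF G])
    \<comment> \<open>For \<open>u = y\<close> this is the definition of \<open>D\<close>; for
      elements of the trace it is the module property.\<close>
    show "d u w = d x w \<and> d w u = d w x" if "u \<in> insert y (F \<inter> D)" "w \<in> F - D" for u w
    proof (cases "u = y")
      case True
      then show ?thesis using that assms by (auto simp: D_def)
    next
      case False
      then show ?thesis using that assms by (intro D_module) auto
    qed
  qed (use assms in auto)
  then show ?thesis by (simp add: Int_Diff_Un)
qed

end

section \<open>From relations to colours, and the theorem\<close>

definition colour :: "'a bstruct \<Rightarrow> 'a \<Rightarrow> 'a \<Rightarrow> nat set" where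
  "colour R u v = {i. i < length (rels R) \<and> (u, v) \<in> rels R ! i}"

text \<open>Equal colours mean membership in the same relations, so one equation replaces the
  conditions for all indices. The inclusions make \<open>A\<close> and \<open>B\<close> the base
  sets of the restrictions.\<close>

lemma isomorphic_restriction_iff_colour_iso:
  assumes "A \<subseteq> base R" "B \<subseteq> base R"
  shows "isomorphic (restriction R A) (restriction R B) \<longleftrightarrow> colour_iso (colour R) A B"
proof -
  have base: "base R \<inter> A = A" "base R \<inter> B = B"
    using assms by auto
  have "isomorphism (restriction R A) (restriction R B) f \<longleftrightarrow>
      bij_betw f A B \<and> (\<forall>u\<in>A. \<forall>v\<in>A. colour R (f u) (f v) = colour R u v)" for f
  proof (cases "bij_betw f A B")
    case True
    have "isomorphism (restriction R A) (restriction R B) f \<longleftrightarrow>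
        (\<forall>i<length (rels R). \<forall>u\<in>A. \<forall>v\<in>A. (u, v) \<in> rels R ! i \<longleftrightarrow> (f u, f v) \<in> rels R ! i)"
      unfolding isomorphism_def restriction_def bstruct.simps base length_map
      using True bij_betw_apply[OF True] by simp
    also have "\<dots> \<longleftrightarrow> (\<forall>u\<in>A. \<forall>v\<in>A. colour R (f u) (f v) = colour R u v)"
      unfolding colour_def set_eq_iff mem_Collect_eq by blast
    finally show ?thesis using True by blast
  next
    case False
    then show ?thesis
      unfolding isomorphism_def restriction_def bstruct.simps base by blast
  qed
  then show ?thesis
    unfolding isomorphic_def colour_iso_def by blast
qed

lemma equiv_set_iff_colour_iso:
  assumes "insert x F \<subseteq> base R" "insert y F \<subseteq> base R"
  shows "equiv_set R F x y \<longleftrightarrow> colour_iso (colour R) (insert x F) (insert y F)"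
  using isomorphic_restriction_iff_colour_iso[OF assms] by (simp add: equiv_set_def)

theorem theorem8p17:
  fixes k :: nat and R :: "'a bstruct"
  assumes "binary_structure k R"
  shows "equiv_upto 3 R = equiv_all R"
proof
  show "equiv_all R \<subseteq> equiv_upto 3 R"
    by (auto simp: equiv_all_def equiv_upto_def)
  show "equiv_upto 3 R \<subseteq> equiv_all R"
  proof (rule subrelI)
    fix x y assume xy: "(x, y) \<in> equiv_upto 3 R"
    then have base: "x \<in> base R" "y \<in> base R" by (auto simp: equiv_upto_def)
    interpret exchange_upto_3 "colour R" "base R" x y
    proof
      fix F assume F: "F \<subseteq> base R - {x, y}" "finite F" "card F \<le> 3"
      then have "equiv_set R F x y"
        using xy unfolding equiv_upto_def equiv_size_def by blast
      then show "colour_iso (colour R) (insert x F) (insert y F)"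
        using equiv_set_iff_colour_iso[of x F R y] F base by blast
    qed
    have "equiv_set R F x y" if "F \<subseteq> base R - {x, y}" "finite F" for F
      using colour_iso_finite[OF that] equiv_set_iff_colour_iso[of x F R y] that base by blast
    then show "(x, y) \<in> equiv_all R"
      using base unfolding equiv_all_def equiv_size_def by blast
  qed
qed

end
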